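(* Let $I\subset\mathbb{R}$ be an interval and let $(\alpha,\ell,m,n):I\to\mathbb{R}^4$ be a smooth mapping. Then there exists a pseudo-spherical timelike framed curve $(\gamma_t,v_1,v_2):I\to AdS^3\times\Delta_5$ whose curvature is $(\alpha,\ell,m,n)$. Moreover, any other pseudo-spherical timelike framed curve $(\tilde\gamma_t,\tilde v_1,\tilde v_2):I\to AdS^3\times\Delta_5$ with the same curvature $(\alpha,\ell,m,n)$ is congruent to it: there is $A\in SO(2,2)$ with $\tilde\gamma_t(s)=A\gamma_t(s)$, $\tilde v_1(s)=Av_1(s)$, $\tilde v_2(s)=Av_2(s)$ for all $s\in I$.
   Context: $\mathbb{R}^4_2$ is $\mathbb{R}^4$ with $\langle u,w\rangle=-u_1w_1-u_2w_2+u_3w_3+u_4w_4$; the triple product $u\times v\times w$ is the unique vector with $\langle x,u\times v\times w\rangle=\det(x,u,v,w)$ for all $x$. $SO(2,2)$ is the group of determinant-one real $4\times4$ matrices preserving $\langle\cdot,\cdot\rangle$. $AdS^3=\{u:\langle u,u\rangle=-1\}$, $S^3_2=\{u:\langle u,u\rangle=1\}$, $\Delta_5=\{(u,w)\in S^3_2\times S^3_2:\langle u,w\rangle=0\}$. A pseudo-spherical timelike framed curve is a smooth map $(\gamma_t,v_1,v_2):I\to AdS^3\times\Delta_5$ with $\langle\gamma_t,v_i\rangle=0$ and $\langle\gamma_t',v_i\rangle=0$ on $I$ for $i=1,2$. Put $\mu=\gamma_t\times v_1\times v_2$ (a unit timelike vector). The curvature is $(\alpha,\ell,m,n)$ with $\alpha=-\langle\gamma_t',\mu\rangle$,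 $\ell=\langle v_1',v_2\rangle$, $m=-\langle v_1',\mu\rangle$, $n=-\langle v_2',\mu\rangle$; equivalently $\gamma_t'=\alpha\mu$, $v_1'=\ell v_2+m\mu$, $v_2'=-\ell v_1+n\mu$, $\mu'=-\alpha\gamma_t+mv_1+nv_2$. *)

theory Defs
  imports "HOL-Analysis.Analysis"
begin

definition inner22 :: "real^4 \<Rightarrow> real^4 \<Rightarrow> real" where
  "inner22 u w = - u$1 * w$1 - u$2 * w$2 + u$3 * w$3 + u$4 * w$4"

definition triple_prod :: "real^4 \<Rightarrow> real^4 \<Rightarrow> real^4 \<Rightarrow> real^4" where
  "triple_prod u v w = (THE z. \<forall>x. inner22 x z = det (vector [x, u, v, w] :: real^4^4))"

definition SO22 :: "(real^4^4) set" where
  "SO22 = {A. det A = 1 \<and> (\<forall>u w. inner22 (A *v u) (A *v w) = inner22 u w)}"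

definition AdS3 :: "(real^4) set" where
  "AdS3 = {u. inner22 u u = -1}"

definition S32 :: "(real^4) set" where
  "S32 = {u. inner22 u u = 1}"

definition Delta5 :: "((real^4) \<times> (real^4)) set" where
  "Delta5 = {(u, w). u \<in> S32 \<and> w \<in> S32 \<and> inner22 u w = 0}"

text \<open>
  Derivatives are taken within the interval, so they are one-sided at those endpoints that
  belong to it.  They are uniquely determined as long as the interval is not degenerate.
\<close>

definition deriv_on :: "real set \<Rightarrow> (real \<Rightarrow> 'a::real_normed_vector) \<Rightarrow> real \<Rightarrow> 'a" where
  "deriv_on I f = (\<lambda>s. vector_derivative f (at s within I))"

definition smooth_on :: "real set \<Rightarrow> (real \<Rightarrow> 'a::real_normed_vector) \<Rightarrow> bool" where
  "smooth_on I f \<longleftrightarrow> (\<forall>k. (deriv_on I ^^ k) f differentiable_on I)"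

definition framed_curve ::
  "real set \<Rightarrow> (real \<Rightarrow> real^4) \<Rightarrow> (real \<Rightarrow> real^4) \<Rightarrow> (real \<Rightarrow> real^4) \<Rightarrow> bool" where
  "framed_curve I \<gamma> v1 v2 \<longleftrightarrow>
     smooth_on I (\<lambda>s. (\<gamma> s, v1 s, v2 s)) \<and>
     (\<forall>s\<in>I. (\<gamma> s, v1 s, v2 s) \<in> AdS3 \<times> Delta5 \<and>
       inner22 (\<gamma> s) (v1 s) = 0 \<and> inner22 (\<gamma> s) (v2 s) = 0 \<and>
       inner22 (deriv_on I \<gamma> s) (v1 s) = 0 \<and> inner22 (deriv_on I \<gamma> s) (v2 s) = 0)"

definition curvature ::
  "real set \<Rightarrow> (real \<Rightarrow> real^4) \<Rightarrow> (real \<Rightarrow> real^4) \<Rightarrow> (real \<Rightarrow> real^4) \<Rightarrow> real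
    \<Rightarrow> real \<times> real \<times> real \<times> real" where
  "curvature I \<gamma> v1 v2 s =
     (let \<mu> = triple_prod (\<gamma> s) (v1 s) (v2 s) in
       (- inner22 (deriv_on I \<gamma> s) \<mu>,
        inner22 (deriv_on I v1 s) (v2 s),
        - inner22 (deriv_on I v1 s) \<mu>,
        - inner22 (deriv_on I v2 s) \<mu>))"

lemma vector_4 [simp]:
  "(vector [a, b, c, d] :: 'a::zero^4) $ 1 = a"
  "(vector [a, b, c, d] :: 'a::zero^4) $ 2 = b"
  "(vector [a, b, c, d] :: 'a::zero^4) $ 3 = c"
  "(vector [a, b, c, d] :: 'a::zero^4) $ 4 = d"
  by (simp_all add: vector_def)

lemma inner22_triple_prod:
  "inner22 x (triple_prod u v w) = det (vector [x, u, v, w] :: real^4^4)"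
proof -
  define D where "D y = det (vector [y, u, v, w] :: real^4^4)" for y
  have D_row: "D y = det ((\<chi> i. if i = 1 then y else vector [0, u, v, w] $ i) :: real^4^4)" for y
    unfolding D_def by (rule arg_cong[where f = det]) (simp add: vec_eq_iff forall_4)
  have D_add: "D (y + z) = D y + D z" for y z
    unfolding D_row by (rule det_row_add)
  have D_scale: "D (c *s y) = c * D y" for c y
    unfolding D_row by (rule det_row_mul)
  have D_expand: "D y = y$1 * D (axis 1 1) + y$2 * D (axis 2 1) + y$3 * D (axis 3 1) + y$4 * D (axis 4 1)"
    for y
  proof -
    have "y = y$1 *s axis 1 1 + y$2 *s axis 2 1 + y$3 *s axis 3 1 + y$4 *s axis 4 1"
      by (simp add: vec_eq_iff forall_4 axis_def)
    then have "D y = D (y$1 *s axis 1 1 + y$2 *s axis 2 1 + y$3 *s axis 3 1 + y$4 *s axis 4 1)"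
      by simp
    then show ?thesis by (simp only: D_add D_scale)
  qed
  have "\<exists>!z. \<forall>x. inner22 x z = D x"
  proof (rule ex1I)
    show "\<forall>x. inner22 x (vector [- D (axis 1 1), - D (axis 2 1), D (axis 3 1), D (axis 4 1)]) = D x"
      by (subst D_expand) (simp add: inner22_def)
  next
    fix z assume "\<forall>x. inner22 x z = D x"
    then have "inner22 (axis i 1) z = D (axis i 1)" for i by blast
    from this[of 1] this[of 2] this[of 3] this[of 4]
    show "z = vector [- D (axis 1 1), - D (axis 2 1), D (axis 3 1), D (axis 4 1)]"
      by (simp add: vec_eq_iff forall_4 inner22_def axis_def)
  qed
  from theI'[OF this] show ?thesis
    unfolding triple_prod_def D_def by blast
qed

end

theory Submission
  imports Defs
begin

text \<open>
  With the frame written as the matrix \<open>F\<close> with rows \<open>\<mu>, \<gamma>, v1, v2\<close>, the Frenet equations become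
  a linear differential equation \<open>F' = K F\<close>.  The coefficient matrix \<open>K\<close> is skew with respect to
  the form, so \<open>J F\<^sup>T J G\<close> is constant for any two solutions \<open>F\<close> and \<open>G\<close>.  For \<open>G = F\<close> this says
  that an orthonormal initial frame stays orthonormal, and for two orthonormal frames the constant
  is \<open>F\<^sup>-\<^sup>1 G\<close>, the transpose of the congruence.  The equation is solved on the whole interval by its
  Picard series.
\<close>

section \<open>Linear differential equations on an interval\<close>

text \<open>Integrating the bound on \<open>f'\<close> from \<open>c\<close> to \<open>x\<close>
  raises the exponent by one and divides by \<open>Suc k\<close>; iterated, these divisors build the
  factorial in the estimate of the Picard terms. The two cases are the two sides of
  \<open>c\<close>.\<close>

lemma norm_le_of_derivative_power_bound:
  fixes f :: "real \<Rightarrow> 'a::euclidean_space"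
  assumes f: "\<And>x. x \<in> {a..b} \<Longrightarrow> (f has_vector_derivative f' x) (at x within {a..b})"
    and c: "c \<in> {a..b}" and x: "x \<in> {a..b}" and "f c = 0"
    and le: "\<And>x. x \<in> {a..b} \<Longrightarrow> norm (f' x) \<le> B * \<bar>x - c\<bar> ^ k"
  shows "norm (f x) \<le> B * \<bar>x - c\<bar> ^ Suc k / Suc k"
proof (cases "c \<le> x")
  case True
  have 1: "(f' has_integral (f x - f c)) {c..x}"
    using c x by (intro fundamental_theorem_of_calculus True
        has_vector_derivative_within_subset[OF f, of _ "{c..x}"]) auto
  have 2: "((\<lambda>t. B * (t - c) ^ k) has_integral
      (B * (x - c) ^ Suc k / Suc k - B * (c - c) ^ Suc k / Suc k)) {c..x}"
    by (intro fundamental_theorem_of_calculus True)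
      (auto intro!: derivative_eq_intros simp del: power_Suc of_nat_Suc simp flip: has_real_derivative_iff_has_vector_derivative)
  have "norm (integral {c..x} f') \<le> integral {c..x} (\<lambda>t. B * (t - c) ^ k)"
  proof (intro integral_norm_bound_integral has_integral_integrable[OF 1] has_integral_integrable[OF 2])
    show "norm (f' t) \<le> B * (t - c) ^ k" if "t \<in> {c..x}" for t
      using le[of t] c x that by simp
  qed
  with True \<open>f c = 0\<close> show ?thesis
    unfolding integral_unique[OF 1] integral_unique[OF 2] by simp
next
  case False
  have 1: "(f' has_integral (f c - f x)) {x..c}"
    using c x False by (intro fundamental_theorem_of_calculus
        has_vector_derivative_within_subset[OF f, of _ "{x..c}"]) auto
  have 2: "((\<lambda>t. B * (c - t) ^ k) has_integral
      (- (B * (c - c) ^ Suc k / Suc k) - - (B * (c - x) ^ Suc k / Suc k))) {x..c}"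
    using False by (intro fundamental_theorem_of_calculus)
      (auto intro!: derivative_eq_intros simp del: power_Suc of_nat_Suc simp flip: has_real_derivative_iff_has_vector_derivative)
  have "norm (integral {x..c} f') \<le> integral {x..c} (\<lambda>t. B * (c - t) ^ k)"
  proof (intro integral_norm_bound_integral has_integral_integrable[OF 1] has_integral_integrable[OF 2])
    show "norm (f' t) \<le> B * (c - t) ^ k" if "t \<in> {x..c}" for t
      using le[of t] c x that by simp
  qed
  with False \<open>f c = 0\<close> show ?thesis
    unfolding integral_unique[OF 1] integral_unique[OF 2] by simp
qed


text \<open>These are the terms of the Picard series; the usual Picard iterates are its partial
  sums. The oriented integral allows \<open>s < c\<close>, and no bounding interval enters, so one
  series serves every compact subinterval.\<close>

primrec picard ::
  "('b::real_normed_vector \<Rightarrow> 'a::euclidean_space \<Rightarrow> 'a) \<Rightarrow> (real \<Rightarrow> 'b) \<Rightarrow> real \<Rightarrow> 'a \<Rightarrow> nat \<Rightarrow> real \<Rightarrow> 'a" where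
  "picard p K c x0 0 = (\<lambda>s. x0)"
| "picard p K c x0 (Suc k) = (\<lambda>s. LBINT y=c..s. p (K y) (picard p K c x0 k y))"

text \<open>On a compact interval the terms are dominated by an exponential series, and so are their
  derivatives up to an index shift. Hence the series may be differentiated term by term.\<close>

lemma linear_ode_picard:
  fixes p :: "'b::real_normed_vector \<Rightarrow> 'a::euclidean_space \<Rightarrow> 'a"
  assumes "bounded_bilinear p" and c: "c \<in> {a..b}" and K: "continuous_on {a..b} K" and s: "s \<in> {a..b}"
  shows "((\<lambda>s. \<Sum>k. picard p K c x0 k s) has_vector_derivative p (K s) (\<Sum>k. picard p K c x0 k s))
    (at s within {a..b})"
proof -
  interpret p: bounded_bilinear p by fact
  define T where "T = picard p K c x0"
  \<comment> \<open>\<open>d k\<close> is the derivative of the \<open>k\<close>-th term: 0 for the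
    constant term, and otherwise given by the preceding term. This shift turns the sum of the
    derivatives into \<open>p\<close> applied to the sum of the terms.\<close>
  define d where "d k s = (case k of 0 \<Rightarrow> 0 | Suc j \<Rightarrow> p (K s) (T j s))" for k s
  have d_simps [simp]: "d 0 s = 0" "d (Suc j) s = p (K s) (T j s)" for j s
    by (simp_all add: d_def)
  have T_deriv: "(T k has_vector_derivative d k x) (at x within {a..b})" if "x \<in> {a..b}" for k x
    using that
  proof (induction k arbitrary: x)
    case 0
    then show ?case by (simp add: T_def)
  next
    case (Suc k)
    have "continuous_on {a..b} (T k)"
      unfolding continuous_on_eq_continuous_within using Suc.IH has_vector_derivative_continuous by blast
    then have "continuous_on {a..b} (\<lambda>y. p (K y) (T k y))"
      by (intro p.continuous_on K)
    from interval_integral_FTC2[OF _ _ this, of c x] c Suc.prems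
    show ?case by (simp add: T_def)
  qed
  obtain C where C: "0 < C" "\<And>u v. norm (p u v) \<le> norm u * norm v * C"
    using p.pos_bounded by blast
  have "bounded (K ` {a..b})"
    using K by (intro compact_imp_bounded compact_continuous_image) auto
  then obtain N where N: "0 < N" "\<And>x. x \<in> {a..b} \<Longrightarrow> norm (K x) \<le> N"
    by (auto simp: bounded_pos)
  \<comment> \<open>\<open>M\<close> bounds the operator norm of \<open>p (K x)\<close> uniformly on
    the interval.\<close>
  define M where "M = N * C"
  have "0 < M" using C N by (simp add: M_def)
  have p_le: "norm (p (K x) v) \<le> M * norm v" if "x \<in> {a..b}" for x v
  proof -
    have "norm (p (K x) v) \<le> norm (K x) * norm v * C" by (rule C)
    also have "\<dots> \<le> N * norm v * C" using N C that by (intro mult_right_mono) auto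
    finally show ?thesis by (simp add: M_def mult_ac)
  qed
  have T_le: "norm (T k x) \<le> norm x0 * M ^ k / fact k * \<bar>x - c\<bar> ^ k" if "x \<in> {a..b}" for k x
    using that
  proof (induction k arbitrary: x)
    case 0
    then show ?case by (simp add: T_def)
  next
    case (Suc k)
    have "norm (T (Suc k) x) \<le> (norm x0 * M ^ Suc k / fact k) * \<bar>x - c\<bar> ^ Suc k / Suc k"
    proof (rule norm_le_of_derivative_power_bound[where f' = "d (Suc k)"])
      fix y assume y: "y \<in> {a..b}"
      have "norm (d (Suc k) y) \<le> M * norm (T k y)" using p_le y by simp
      also have "\<dots> \<le> M * (norm x0 * M ^ k / fact k * \<bar>y - c\<bar> ^ k)"
        using Suc.IH[OF y] \<open>0 < M\<close> by (intro mult_left_mono) auto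
      finally show "norm (d (Suc k) y) \<le> norm x0 * M ^ Suc k / fact k * \<bar>y - c\<bar> ^ k"
        by (simp add: mult_ac)
    next
      show "T (Suc k) c = 0" by (simp add: T_def)
    qed (use T_deriv c Suc.prems in blast)+
    then show ?case by (simp add: mult_ac)
  qed
  define L where "L = b - a"
  define m where "m k = norm x0 * (M * L) ^ k / fact k" for k
  have T_le_m: "norm (T k x) \<le> m k" if "x \<in> {a..b}" for k x
  proof -
    have "\<bar>x - c\<bar> ^ k \<le> L ^ k" using c that by (intro power_mono) (auto simp: L_def)
    then have "norm x0 * M ^ k / fact k * \<bar>x - c\<bar> ^ k \<le> norm x0 * M ^ k / fact k * L ^ k"
      using \<open>0 < M\<close> by (intro mult_left_mono) auto
    with T_le[OF that, of k] show ?thesis by (simp add: m_def power_mult_distrib)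
  qed
  have m: "summable m"
  proof -
    have "summable (\<lambda>k. norm x0 * (inverse (fact k) * (M * L) ^ k))"
      by (intro summable_mult summable_exp)
    then show ?thesis by (simp add: m_def[abs_def] field_simps)
  qed
  have T_summable: "summable (\<lambda>k. T k x)" if "x \<in> {a..b}" for x
    using T_le_m[OF that] by (intro summable_comparison_test'[OF m])
  have d_summable: "summable (\<lambda>k. d k x)" and d_sum: "(\<Sum>k. d k x) = p (K x) (\<Sum>k. T k x)"
    if "x \<in> {a..b}" for x
  proof -
    have "(\<lambda>k. d (Suc k) x) sums p (K x) (\<Sum>k. T k x)"
      using bounded_linear.sums[OF p.bounded_linear_right summable_sums[OF T_summable[OF that]]] by simp
    then have "(\<lambda>k. d k x) sums p (K x) (\<Sum>k. T k x)"
      by (subst (asm) sums_Suc_iff) simp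
    then show "summable (\<lambda>k. d k x)" "(\<Sum>k. d k x) = p (K x) (\<Sum>k. T k x)"
      by (auto simp: sums_iff)
  qed
  \<comment> \<open>Differentiating a series requires uniform convergence of the derivatives; the
    majorant is \<open>M * m j\<close>, shifted by one like \<open>d\<close>.\<close>
  have unif: "uniform_limit {a..b} (\<lambda>k x. \<Sum>i<k. d i x) (\<lambda>x. \<Sum>k. d k x) sequentially"
  proof (rule Weierstrass_m_test)
    show "norm (d k x) \<le> (case k of 0 \<Rightarrow> 0 | Suc j \<Rightarrow> M * m j)" if "x \<in> {a..b}" for k x
    proof (cases k)
      case (Suc j)
      have "M * norm (T j x) \<le> M * m j" using T_le_m[OF that] \<open>0 < M\<close> by auto
      with p_le[OF that, of "T j x"] Suc show ?thesis by simp
    qed simp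
    show "summable (\<lambda>k. case k of 0 \<Rightarrow> 0 | Suc j \<Rightarrow> M * m j)"
      by (subst summable_Suc_iff[symmetric]) (simp add: m summable_mult)
  qed
  have "\<exists>g. \<forall>x\<in>{a..b}. (\<lambda>k. T k x) sums g x \<and>
      (g has_derivative (\<lambda>h. h *\<^sub>R p (K x) (\<Sum>k. T k x))) (at x within {a..b})"
  proof (rule has_derivative_series)
    show "(T k has_derivative (\<lambda>h. h *\<^sub>R d k x)) (at x within {a..b})" if "x \<in> {a..b}" for k x
      using T_deriv[OF that] by (simp add: has_vector_derivative_def)
    show "(\<lambda>k. T k c) sums (\<Sum>k. T k c)" using T_summable c by auto
    show "\<forall>\<^sub>F k in sequentially. \<forall>x\<in>{a..b}. \<forall>h.
        norm ((\<Sum>i<k. h *\<^sub>R d i x) - h *\<^sub>R p (K x) (\<Sum>k. T k x)) \<le> e * norm h" if "0 < e" for e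
      using uniform_limitD[OF unif \<open>0 < e\<close>]
    proof (rule eventually_mono, intro ballI allI)
      fix k x h assume *: "\<forall>x\<in>{a..b}. dist (\<Sum>i<k. d i x) (\<Sum>k. d k x) < e" and x: "x \<in> {a..b}"
      have "norm ((\<Sum>i<k. h *\<^sub>R d i x) - h *\<^sub>R p (K x) (\<Sum>k. T k x))
          = \<bar>h\<bar> * norm ((\<Sum>i<k. d i x) - p (K x) (\<Sum>k. T k x))"
        by (simp flip: scaleR_sum_right scaleR_diff_right)
      also have "\<dots> \<le> \<bar>h\<bar> * e"
        using *[rule_format, OF x] by (intro mult_left_mono) (auto simp: dist_norm d_sum[OF x])
      finally show "norm ((\<Sum>i<k. h *\<^sub>R d i x) - h *\<^sub>R p (K x) (\<Sum>k. T k x)) \<le> e * norm h"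
        by (simp add: mult.commute)
    qed
  qed (use c in auto)
  \<comment> \<open>The sum function \<open>g\<close> is only known on \<open>{a..b}\<close>, where
    it agrees with the pointwise sum; a derivative within the interval depends on nothing
    else.\<close>
  then obtain g where g: "\<And>x. x \<in> {a..b} \<Longrightarrow> g x = (\<Sum>k. T k x)"
    "\<And>x. x \<in> {a..b} \<Longrightarrow> (g has_vector_derivative p (K x) (\<Sum>k. T k x)) (at x within {a..b})"
    by (metis has_vector_derivative_def sums_unique)
  show ?thesis
    using has_vector_derivative_transform[OF s _ g(2)[OF s], of "\<lambda>s. \<Sum>k. T k s"] g(1)
    by (simp add: T_def)
qed

text \<open>Reduces differentiation within an arbitrary interval to the compact case. The ends are
  chosen strictly beyond \<open>s\<close> on each side where \<open>I\<close> continues past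
  \<open>s\<close>, so near \<open>s\<close> the two sets coincide.\<close>

lemma compact_interval_around:
  fixes I :: "real set"
  assumes "is_interval I" "c \<in> I" "s \<in> I"
  obtains a b where "{a..b} \<subseteq> I" "c \<in> {a..b}" "s \<in> {a..b}" "at s within I = at s within {a..b}"
proof -
  obtain a where a: "a \<in> I" "a \<le> c" "a \<le> s" "a < s \<or> (\<forall>x\<in>I. s \<le> x)"
    using assms by (metis le_less_linear less_le_trans linear order.refl)
  obtain b where b: "b \<in> I" "c \<le> b" "s \<le> b" "s < b \<or> (\<forall>x\<in>I. x \<le> s)"
    using assms by (metis le_less_linear less_le_trans le_less_trans linear order.refl)
  have sub: "{a..b} \<subseteq> I"
    using assms(1) a(1) b(1) by (meson atLeastAtMost_iff mem_is_interval_1_I subsetI)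
  \<comment> \<open>An open neighbourhood of \<open>s\<close>, cut off only on the sides where
    \<open>I\<close> may leave \<open>{a..b}\<close>.\<close>
  define S where "S = (if a < s then {a<..} else UNIV) \<inter> (if s < b then {..<b} else UNIV)"
  have "at s within I = at s within {a..b}"
  proof (rule at_within_nhd[of _ S])
    have "x \<in> {a..b}" if "x \<in> I" "x \<in> S" for x
      using that a b by (force simp: S_def split: if_splits)
    with sub show "I \<inter> S - {s} = {a..b} \<inter> S - {s}" by blast
  qed (auto simp: S_def)
  with that sub a b show ?thesis by auto
qed

text \<open>The same Picard series solves the equation on every compact subinterval around
  \<open>c\<close>, so no local solutions have to be glued.\<close>

lemma linear_ode_exists:
  fixes p :: "'b::real_normed_vector \<Rightarrow> 'a::euclidean_space \<Rightarrow> 'a"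
  assumes p: "bounded_bilinear p" and I: "is_interval I" "c \<in> I" and K: "continuous_on I K"
  obtains x where "x c = x0" "\<And>s. s \<in> I \<Longrightarrow> (x has_vector_derivative p (K s) (x s)) (at s within I)"
proof -
  let ?x = "\<lambda>s. \<Sum>k. picard p K c x0 k s"
  have "picard p K c x0 k c = (if k = 0 then x0 else 0)" for k
    by (cases k) auto
  then have "(\<lambda>k. picard p K c x0 k c) sums x0"
    using sums_single[of 0 "\<lambda>_. x0"] by presburger
  then have "?x c = x0" by (simp add: sums_iff)
  moreover have "(?x has_vector_derivative p (K s) (?x s)) (at s within I)" if s: "s \<in> I" for s
  proof -
    obtain a b where ab: "{a..b} \<subseteq> I" "c \<in> {a..b}" "s \<in> {a..b}" "at s within I = at s within {a..b}"
      by (rule compact_interval_around[OF I s])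
    show ?thesis
      unfolding ab(4) by (rule linear_ode_picard[OF p ab(2) continuous_on_subset[OF K ab(1)] ab(3)])
  qed
  ultimately show ?thesis by (rule that[of ?x])
qed

section \<open>Smooth functions on an interval\<close>

text \<open>Every point of a nondegenerate interval is a limit point of it, which makes derivatives
  within the interval unique.\<close>

lemma at_within_interval_neq_bot:
  fixes I :: "real set"
  assumes "is_interval I" "interior I \<noteq> {}" "s \<in> I"
  shows "at s within I \<noteq> bot"
proof -
  have "I \<noteq> {x}" for x using assms(2) by auto
  then have "s islimpt I"
    using connected_imp_perfect[of I s] assms is_interval_connected by blast
  then show ?thesis by (simp add: trivial_limit_within)
qed

lemma deriv_on_eqI:
  fixes I :: "real set"
  assumes "is_interval I" "interior I \<noteq> {}" "s \<in> I" "(f has_vector_derivative f') (at s within I)"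
  shows "deriv_on I f s = f'"
  unfolding deriv_on_def
  using vector_derivative_within[OF at_within_interval_neq_bot[OF assms(1-3)] assms(4)] .

lemma deriv_on_works:
  assumes "f differentiable_on I" "s \<in> I"
  shows "(f has_vector_derivative deriv_on I f s) (at s within I)"
  using assms unfolding deriv_on_def differentiable_on_def by (simp add: vector_derivative_works)

lemma differentiable_onI_vector:
  assumes "\<And>s. s \<in> I \<Longrightarrow> (f has_vector_derivative f' s) (at s within I)"
  shows "f differentiable_on I"
  using assms unfolding differentiable_on_def differentiable_def has_vector_derivative_def by blast

text \<open>Finite-order differentiability, peeling off the first derivative rather than the last;
  this suits inductions on the order with \<open>f\<close> arbitrary.\<close>

primrec diff_on :: "nat \<Rightarrow> real set \<Rightarrow> (real \<Rightarrow> 'a::real_normed_vector) \<Rightarrow> bool" where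
  "diff_on 0 I f \<longleftrightarrow> True"
| "diff_on (Suc k) I f \<longleftrightarrow> f differentiable_on I \<and> diff_on k I (deriv_on I f)"

lemma diff_on_iff: "diff_on k I f \<longleftrightarrow> (\<forall>j<k. (deriv_on I ^^ j) f differentiable_on I)"
proof (induction k arbitrary: f)
  case (Suc k)
  then show ?case by (simp add: All_less_Suc2 funpow_swap1 del: funpow.simps(2) flip: funpow_Suc_right)
    (simp add: funpow_swap1)
qed simp

lemma smooth_on_iff: "smooth_on I f \<longleftrightarrow> (\<forall>k. diff_on k I f)"
  unfolding smooth_on_def diff_on_iff by blast

lemma diff_on_SucD: "diff_on (Suc k) I f \<Longrightarrow> diff_on k I f"
  by (simp add: diff_on_iff)

context

  \<comment> \<open>Closure properties of finite-order differentiability on a nondegenerate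
    interval\<close>
  fixes I :: "real set"
  assumes I: "is_interval I" "interior I \<noteq> {}"
begin

text \<open>A derivative computed by a rule agrees with \<open>deriv_on I f\<close> only on
  \<open>I\<close>, so the recursion in \<open>diff_on\<close> must be insensitive to values
  elsewhere.\<close>

lemma diff_on_cong:
  assumes "\<And>s. s \<in> I \<Longrightarrow> f s = g s" "diff_on k I f"
  shows "diff_on k I g"
  using assms
proof (induction k arbitrary: f g)
  case (Suc k)
  have g: "(g has_vector_derivative deriv_on I f s) (at s within I)" if "s \<in> I" for s
    using Suc.prems that deriv_on_works[of f I s]
    by (intro has_vector_derivative_transform[of s I g f]) auto
  moreover have "diff_on k I (deriv_on I g)"
  proof (rule Suc.IH)
    show "deriv_on I f s = deriv_on I g s" if "s \<in> I" for s
      using deriv_on_eqI[OF I that g[OF that]] by simp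
  qed (use Suc.prems in simp)
  ultimately show ?case using differentiable_onI_vector[OF g] by simp
qed simp

lemma diff_on_SucI:
  assumes "\<And>s. s \<in> I \<Longrightarrow> (f has_vector_derivative f' s) (at s within I)" "diff_on k I f'"
  shows "diff_on (Suc k) I f"
proof -
  have "f' s = deriv_on I f s" if "s \<in> I" for s
    using deriv_on_eqI[OF I that assms(1)[OF that]] by simp
  with diff_on_cong[OF _ assms(2)] differentiable_onI_vector[OF assms(1)] show ?thesis by simp
qed

lemma diff_on_add: "diff_on k I f \<Longrightarrow> diff_on k I g \<Longrightarrow> diff_on k I (\<lambda>s. f s + g s)"
proof (induction k arbitrary: f g)
  case (Suc k)
  then show ?case
    by (intro diff_on_SucI[where f' = "\<lambda>s. deriv_on I f s + deriv_on I g s"] has_vector_derivative_add)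
      (auto intro: deriv_on_works)
qed simp

lemma diff_on_linear: "bounded_linear h \<Longrightarrow> diff_on k I f \<Longrightarrow> diff_on k I (\<lambda>s. h (f s))"
proof (induction k arbitrary: f)
  case (Suc k)
  then show ?case
    by (intro diff_on_SucI[where f' = "\<lambda>s. h (deriv_on I f s)"] bounded_linear.has_vector_derivative[of h])
      (auto intro: deriv_on_works)
qed simp

lemma diff_on_bilinear:
  assumes "bounded_bilinear h"
  shows "diff_on k I f \<Longrightarrow> diff_on k I g \<Longrightarrow> diff_on k I (\<lambda>s. h (f s) (g s))"
proof (induction k arbitrary: f g)
  case (Suc k)
  then show ?case
    \<comment> \<open>Each summand of the product rule keeps one factor undifferentiated, so the
      induction also needs \<open>f\<close> and \<open>g\<close> themselves at order
      \<open>k\<close>.\<close>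
    using diff_on_SucD[OF Suc.prems(1)] diff_on_SucD[OF Suc.prems(2)]
    by (intro diff_on_SucI[where f' = "\<lambda>s. h (f s) (deriv_on I g s) + h (deriv_on I f s) (g s)"]
        bounded_bilinear.has_vector_derivative[OF assms] diff_on_add)
      (auto intro: deriv_on_works)
qed simp

lemma smooth_on_linear: "bounded_linear h \<Longrightarrow> smooth_on I f \<Longrightarrow> smooth_on I (\<lambda>s. h (f s))"
  by (simp add: smooth_on_iff diff_on_linear)

text \<open>Bootstrapping: if \<open>x\<close> has order \<open>k\<close>, so does the right-hand
  side, which is the derivative of \<open>x\<close>; hence \<open>x\<close> has order
  \<open>Suc k\<close>.\<close>

lemma smooth_on_linear_ode_solution:
  assumes p: "bounded_bilinear p" and K: "smooth_on I K"
    and x: "\<And>s. s \<in> I \<Longrightarrow> (x has_vector_derivative p (K s) (x s)) (at s within I)"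
  shows "smooth_on I x"
  unfolding smooth_on_iff
proof
  fix k show "diff_on k I x"
  proof (induction k)
    case (Suc k)
    show ?case
      by (intro diff_on_SucI[OF x] diff_on_bilinear[OF p] Suc K[unfolded smooth_on_iff, rule_format])
  qed simp
qed

end

lemma smooth_on_imp_differentiable_on: "smooth_on I f \<Longrightarrow> f differentiable_on I"
  unfolding smooth_on_def by (metis funpow_0)

section \<open>Orthonormal frames\<close>

lemma bounded_bilinear_matrix_matrix_mult:
  "bounded_bilinear ((**) :: real^'n^'m \<Rightarrow> real^'p^'n \<Rightarrow> real^'p^'m)"
  unfolding bilinear_conv_bounded_bilinear[symmetric] bilinear_def
  by (auto intro!: linearI simp: matrix_matrix_mult_def vec_eq_iff sum.distrib sum_distrib_left algebra_simps)

lemma bounded_linear_transpose: "bounded_linear (transpose :: real^'n^'m \<Rightarrow> real^'m^'n)"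
  unfolding linear_conv_bounded_linear[symmetric]
  by (auto intro!: linearI simp: transpose_def vec_eq_iff)

lemma differentiable_on_det:
  fixes M :: "real \<Rightarrow> real^'n^'n"
  assumes "M differentiable_on I"
  shows "(\<lambda>s. det (M s)) differentiable_on I"
  unfolding differentiable_on_def
proof
  fix s assume "s \<in> I"
  with assms obtain M' where M': "(M has_derivative M') (at s within I)"
    unfolding differentiable_on_def differentiable_def by blast
  have "((\<lambda>s. M s $ i $ j) has_derivative (\<lambda>h. M' h $ i $ j)) (at s within I)" for i j
    using M' by (intro bounded_linear.has_derivative[OF bounded_linear_vec_nth])
  then have "(\<lambda>s. \<Prod>i\<in>UNIV. M s $ i $ p i) differentiable at s within I" for p
    unfolding differentiable_def by (intro exI) (rule has_derivative_prod)
  then show "(\<lambda>s. det (M s)) differentiable at s within I"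
    unfolding det_def
    by (intro differentiable_sum ballI differentiable_mult differentiable_const)
      (simp_all add: finite_permutations)
qed

section \<open>The matrix of the form and Gram matrices\<close>

definition J :: "real^4^4" where
  "J = vector [- axis 1 1, - axis 2 1, axis 3 1, axis 4 1]"

lemma J_nth [simp]: "J $ i = (if i = 1 \<or> i = 2 then - axis i 1 else axis i 1)"
  using exhaust_4[of i] by (auto simp: J_def)

lemma J_J [simp]: "J ** J = mat 1"
  by (simp add: matrix_matrix_mult_def vec_eq_iff forall_4 sum_4 mat_def axis_def)

lemma transpose_J [simp]: "transpose J = J"
  by (simp add: transpose_def vec_eq_iff forall_4 axis_def)

lemma det_J [simp]: "det J = 1"
proof -
  have "det J = prod (\<lambda>i. J $ i $ i) UNIV"
    by (rule det_diagonal) (auto simp: axis_def)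
  then show ?thesis unfolding UNIV_4 by (simp add: axis_def)
qed

lemma J_gram_nth: "(X ** J ** transpose Y) $ i $ j = inner22 (X $ i) (Y $ j)"
  by (simp add: matrix_matrix_mult_def sum_4 transpose_def inner22_def axis_def)

lemma inner22_J: "inner22 u w = u \<bullet> (J *v w)"
  by (simp add: inner22_def inner_vec_def matrix_vector_mult_def sum_4 axis_def)

text \<open>Since \<open>J\<close> is its own inverse, the hypothesis makes
  \<open>J ** transpose G ** J\<close> a right inverse of \<open>G\<close>, and for square matrices
  a right inverse is a left inverse.\<close>

lemma gram_left_inverse:
  assumes "G ** J ** transpose G = J"
  shows "J ** transpose G ** J ** G = mat 1"
proof -
  have "G ** (J ** transpose G ** J) = mat 1"
    using assms by (simp add: matrix_mul_assoc)
  then show ?thesis using matrix_left_right_inverse by blast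
qed

lemma gram_right_inverse:
  assumes "J ** transpose G ** J ** G = mat 1"
  shows "G ** J ** transpose G = J"
proof -
  have "G ** (J ** transpose G ** J) = mat 1"
    using assms matrix_left_right_inverse by blast
  then have "G ** (J ** transpose G ** J) ** J = J" by simp
  then show ?thesis by (simp add: matrix_mul_assoc[symmetric])
qed

text \<open>Rows are listed in the order \<open>\<mu>, \<gamma>, v1, v2\<close>; with this order the Gram matrix of a frame is
  the matrix \<open>J\<close> of the ambient form itself, and the determinant of the frame is
  \<open>inner22 \<mu> \<mu>\<close>.\<close>

definition frame :: "real^4 \<Rightarrow> real^4 \<Rightarrow> real^4 \<Rightarrow> real^4^4" where
  "frame u v w = vector [triple_prod u v w, u, v, w]"

lemma det_equal_rows_4:
  "det (vector [u, u, v, w] :: real^4^4) = 0"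
  "det (vector [v, u, v, w] :: real^4^4) = 0"
  "det (vector [w, u, v, w] :: real^4^4) = 0"
  by (rule det_identical_rows[of 1 2] det_identical_rows[of 1 3] det_identical_rows[of 1 4];
      simp add: row_def)+

text \<open>Supplies a test vector for the determinant: take a vector outside the three-dimensional
  span and subtract its orthogonal projection.\<close>

lemma ex_det_nonzero:
  assumes "inner22 u u = -1" "inner22 v v = 1" "inner22 w w = 1"
    "inner22 u v = 0" "inner22 u w = 0" "inner22 v w = 0"
  obtains x where "det (vector [x, u, v, w] :: real^4^4) \<noteq> 0"
    "inner22 x u = 0" "inner22 x v = 0" "inner22 x w = 0"
proof -
  have "dim (span {u, v, w}) \<le> card {u, v, w}" by (simp add: dim_le_card')
  also have "\<dots> \<le> 3" by (simp add: card_insert_if)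
  also have "3 < dim (UNIV :: (real^4) set)" by simp
  finally have "span {u, v, w} \<noteq> UNIV" by (metis less_irrefl)
  then obtain y where y: "y \<notin> span {u, v, w}" by blast
  have lin: "inner22 (a *\<^sub>R u + b *\<^sub>R v + d *\<^sub>R w) z = a * inner22 u z + b * inner22 v z + d * inner22 w z" for a b d z
    by (simp add: inner22_def algebra_simps)
  have sym: "inner22 z z' = inner22 z' z" for z z' by (simp add: inner22_def)
  have minus: "inner22 (z - z') t = inner22 z t - inner22 z' t" for z z' t
    by (simp add: inner22_def algebra_simps)
  \<comment> \<open>The projection of \<open>y\<close> to the span; the first coefficient is negated
    because \<open>inner22 u u = -1\<close>.\<close>
  define p where "p = (- inner22 y u) *\<^sub>R u + inner22 y v *\<^sub>R v + inner22 y w *\<^sub>R w"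
  define x where "x = y - p"
  have x_orth: "inner22 x u = 0" "inner22 x v = 0" "inner22 x w = 0"
    unfolding x_def p_def minus lin using assms sym by simp_all
  have "p \<in> span {u, v, w}"
    unfolding p_def by (intro span_add span_scale span_base) auto
  then have x: "x \<notin> span {u, v, w}"
    using y span_add[of x "{u, v, w}" p] by (auto simp: x_def)
  have "\<exists>B. (vector [x, u, v, w] :: real^4^4) ** B = mat 1"
    unfolding matrix_right_invertible_independent_rows
  proof (intro allI impI)
    fix c :: "4 \<Rightarrow> real" and i
    assume "(\<Sum>i\<in>UNIV. c i *s row i (vector [x, u, v, w])) = 0"
    then have *: "c 1 *\<^sub>R x + c 2 *\<^sub>R u + c 3 *\<^sub>R v + c 4 *\<^sub>R w = 0"
      by (simp add: sum_4 row_def scalar_mult_eq_scaleR)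
    have "c 1 = 0"
    proof (rule ccontr)
      assume "c 1 \<noteq> 0"
      have "c 1 *\<^sub>R x = - (c 2 *\<^sub>R u + c 3 *\<^sub>R v + c 4 *\<^sub>R w)"
        using * by (simp add: add_eq_0_iff2 add.assoc)
      also have "\<dots> \<in> span {u, v, w}"
        by (intro span_neg span_add span_scale span_base) auto
      finally have "inverse (c 1) *\<^sub>R c 1 *\<^sub>R x \<in> span {u, v, w}" by (rule span_scale)
      then show False using x \<open>c 1 \<noteq> 0\<close> by simp
    qed
    have "inner22 (c 2 *\<^sub>R u + c 3 *\<^sub>R v + c 4 *\<^sub>R w) y = 0" for y
      using * \<open>c 1 = 0\<close> by (simp add: inner22_def)
    from this[of u] this[of v] this[of w] have "c 2 = 0" "c 3 = 0" "c 4 = 0"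
      unfolding lin using assms sym by simp_all
    with \<open>c 1 = 0\<close> show "c i = 0" using exhaust_4[of i] by auto
  qed
  then have "det (vector [x, u, v, w] :: real^4^4) \<noteq> 0"
    by (metis det_I det_mul mult_zero_left zero_neq_one)
  with that x_orth show ?thesis by blast
qed

text \<open>Repeated rows make \<open>triple_prod u v w\<close> orthogonal to \<open>u\<close>,
  \<open>v\<close>, \<open>w\<close>, and its square is \<open>det (frame u v w)\<close>. So
  everything reduces to this determinant, whose sign the Gram relation alone would leave
  open.\<close>

lemma frame_orthonormal:
  assumes "inner22 u u = -1" "inner22 v v = 1" "inner22 w w = 1"
    "inner22 u v = 0" "inner22 u w = 0" "inner22 v w = 0"
  shows "frame u v w ** J ** transpose (frame u v w) = J" "det (frame u v w) = -1"
proof -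
  define \<mu> where "\<mu> = triple_prod u v w"
  have sym: "inner22 y z = inner22 z y" for y z by (simp add: inner22_def)
  have \<mu>: "inner22 u \<mu> = 0" "inner22 v \<mu> = 0" "inner22 w \<mu> = 0"
    "inner22 \<mu> \<mu> = det (frame u v w)" "inner22 x \<mu> = det (vector [x, u, v, w] :: real^4^4)" for x
    by (simp_all add: \<mu>_def inner22_triple_prod det_equal_rows_4 frame_def)
  obtain x where x: "det (vector [x, u, v, w] :: real^4^4) \<noteq> 0"
    "inner22 x u = 0" "inner22 x v = 0" "inner22 x w = 0"
    using ex_det_nonzero[OF assms] .
  let ?X = "vector [x, u, v, w] :: real^4^4"
  \<comment> \<open>Evaluating the determinant of this diagonal mixed Gram matrix in two ways gives \<open>det (frame u v w)\<close>.\<close>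
  have "det (?X ** J ** transpose (frame u v w)) = - inner22 x \<mu>"
  proof -
    have "det (?X ** J ** transpose (frame u v w)) = prod (\<lambda>i. (?X ** J ** transpose (frame u v w)) $ i $ i) UNIV"
    proof (rule det_diagonal)
      fix i j :: 4 assume "i \<noteq> j"
      then show "(?X ** J ** transpose (frame u v w)) $ i $ j = 0"
        unfolding J_gram_nth using exhaust_4[of i] exhaust_4[of j] assms \<mu>(1-3) x(2-4) sym
        by (auto simp: frame_def simp flip: \<mu>_def)
    qed
    then show ?thesis unfolding J_gram_nth UNIV_4 using assms by (simp add: frame_def \<mu>_def)
  qed
  also have "det (?X ** J ** transpose (frame u v w)) = det ?X * det (frame u v w)"
    by (simp add: det_mul)
  finally have "det ?X * det (frame u v w) = det ?X * -1" using \<mu>(5)[of x] by simp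
  then show det: "det (frame u v w) = -1" using x(1) by (simp only: mult_cancel_left) simp
  show "frame u v w ** J ** transpose (frame u v w) = J"
    unfolding vec_eq_iff J_gram_nth using assms \<mu>(1-4) det sym
    by (simp add: forall_4 frame_def axis_def flip: \<mu>_def)
qed

text \<open>Both vectors have the same products with all rows of \<open>F\<close>, and
  \<open>F\<close> is invertible. The assumption \<open>det F = -1\<close> fixes the sign of the
  first row.\<close>

lemma triple_prod_of_orthonormal:
  assumes F: "F ** J ** transpose F = J" and "det F = -1"
  shows "triple_prod (F $ 2) (F $ 3) (F $ 4) = F $ 1"
proof -
  have F_eq: "F = vector [F $ 1, F $ 2, F $ 3, F $ 4]"
    by (simp add: vec_eq_iff forall_4)
  define \<mu> where "\<mu> = triple_prod (F $ 2) (F $ 3) (F $ 4)"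
  have "inner22 (F $ i) \<mu> = inner22 (F $ i) (F $ 1)" for i
  proof -
    have "inner22 (F $ i) (F $ 1) = J $ i $ 1"
      using F J_gram_nth[of F F i 1] by simp
    moreover have "inner22 (F $ 1) \<mu> = -1"
      using assms(2) F_eq by (simp add: \<mu>_def inner22_triple_prod)
    ultimately show ?thesis
      using exhaust_4[of i] by (auto simp: \<mu>_def inner22_triple_prod det_equal_rows_4 axis_def)
  qed
  then have "F *v (J *v \<mu>) = F *v (J *v (F $ 1))"
    unfolding vec_eq_iff matrix_vector_mul_component inner22_J by blast
  then have "J ** transpose F ** J ** F *v (J *v \<mu>) = J ** transpose F ** J ** F *v (J *v (F $ 1))"
    by (simp only: matrix_vector_mul_assoc[symmetric])
  then have "J *v (J *v \<mu>) = J *v (J *v (F $ 1))"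
    by (simp add: gram_left_inverse[OF F])
  then show ?thesis by (simp add: matrix_vector_mul_assoc \<mu>_def)
qed

section \<open>The Frenet equations\<close>

lemma bounded_linear_vector4:
  "bounded_linear (\<lambda>(a, b, c, d). vector [a, b, c, d] :: 'a::euclidean_space^4)"
  unfolding linear_conv_bounded_linear[symmetric]
  by (rule linearI) (auto simp: vec_eq_iff forall_4)

lemma differentiable_on_vector4:
  fixes a b c d :: "real \<Rightarrow> 'a::euclidean_space"
  assumes "a differentiable_on I" "b differentiable_on I" "c differentiable_on I" "d differentiable_on I"
  shows "(\<lambda>s. vector [a s, b s, c s, d s] :: 'a^4) differentiable_on I"
proof (rule differentiable_onI_vector)
  fix s assume s: "s \<in> I"
  have "((\<lambda>s. (a s, b s, c s, d s)) has_vector_derivative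
      (deriv_on I a s, deriv_on I b s, deriv_on I c s, deriv_on I d s)) (at s within I)"
    using assms s by (intro has_vector_derivative_Pair deriv_on_works)
  from bounded_linear.has_vector_derivative[OF bounded_linear_vector4 this]
  show "((\<lambda>s. vector [a s, b s, c s, d s] :: 'a^4) has_vector_derivative
      vector [deriv_on I a s, deriv_on I b s, deriv_on I c s, deriv_on I d s]) (at s within I)"
    by simp
qed

text \<open>Pairing with the standard basis gives the coordinates as determinants, from which
  differentiability can be read off.\<close>

lemma triple_prod_eq:
  "triple_prod u v w = vector
    [- det (vector [axis 1 1, u, v, w] :: real^4^4), - det (vector [axis 2 1, u, v, w] :: real^4^4),
     det (vector [axis 3 1, u, v, w] :: real^4^4), det (vector [axis 4 1, u, v, w] :: real^4^4)]"
  by (simp add: vec_eq_iff forall_4 inner22_def axis_def flip: inner22_triple_prod)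

lemma differentiable_on_frame:
  fixes u v w :: "real \<Rightarrow> real^4"
  assumes "u differentiable_on I" "v differentiable_on I" "w differentiable_on I"
  shows "(\<lambda>s. frame (u s) (v s) (w s)) differentiable_on I"
proof -
  have det: "(\<lambda>s. det (vector [axis i 1, u s, v s, w s] :: real^4^4)) differentiable_on I" for i
    by (rule differentiable_on_det[OF differentiable_on_vector4[OF differentiable_on_const assms]])
  have "(\<lambda>s. triple_prod (u s) (v s) (w s)) differentiable_on I"
    unfolding triple_prod_eq
    by (rule differentiable_on_vector4[OF differentiable_on_minus[OF det] differentiable_on_minus[OF det] det det])
  then show ?thesis
    unfolding frame_def by (rule differentiable_on_vector4[OF _ assms])
qed

text \<open>The Frenet coefficients, row by row for \<mu>', \<gamma>', \<open>v1'\<close>,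
  \<open>v2'\<close> in terms of the same ordered frame.\<close>

definition curvature_matrix :: "real \<times> real \<times> real \<times> real \<Rightarrow> real^4^4" where
  "curvature_matrix = (\<lambda>(a, l, m, n).
     vector [vector [0, - a, m, n], vector [a, 0, 0, 0], vector [m, 0, 0, l], vector [n, 0, - l, 0]])"

lemma bounded_linear_curvature_matrix: "bounded_linear curvature_matrix"
  unfolding linear_conv_bounded_linear[symmetric] curvature_matrix_def
  by (rule linearI) (auto simp: vec_eq_iff forall_4)

text \<open>This is membership in the Lie algebra of the isometry group of the form.\<close>

lemma curvature_matrix_skew: "transpose (curvature_matrix k) ** J = - (J ** curvature_matrix k)"
  by (cases k)
    (simp add: curvature_matrix_def transpose_def matrix_matrix_mult_def vec_eq_iff forall_4 sum_4 axis_def)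

lemma bounded_linear_pairing: "bounded_linear (\<lambda>X :: real^4^4. J ** transpose X ** J)"
  by (intro bounded_linear_compose[OF bounded_bilinear.bounded_linear_left[OF bounded_bilinear_matrix_matrix_mult]]
      bounded_linear_compose[OF bounded_bilinear.bounded_linear_right[OF bounded_bilinear_matrix_matrix_mult]]
      bounded_linear_transpose)

lemmas matrix_minus_left = bounded_bilinear.minus_left[OF bounded_bilinear_matrix_matrix_mult]
lemmas matrix_minus_right = bounded_bilinear.minus_right[OF bounded_bilinear_matrix_matrix_mult]

text \<open>By skewness the two terms of the product rule cancel.\<close>

lemma pairing_constant:
  assumes I: "is_interval I"
    and F: "\<And>s. s \<in> I \<Longrightarrow> (F has_vector_derivative curvature_matrix (k s) ** F s) (at s within I)"
    and G: "\<And>s. s \<in> I \<Longrightarrow> (G has_vector_derivative curvature_matrix (k s) ** G s) (at s within I)"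
  obtains B where "\<And>s. s \<in> I \<Longrightarrow> J ** transpose (F s) ** J ** G s = B"
proof -
  have "((\<lambda>s. J ** transpose (F s) ** J ** G s) has_vector_derivative 0) (at s within I)" if s: "s \<in> I" for s
  proof -
    let ?K = "curvature_matrix (k s)"
    have "J ** transpose (?K ** F s) ** J = J ** transpose (F s) ** (transpose ?K ** J)"
      by (simp add: matrix_transpose_mul matrix_mul_assoc)
    also have "\<dots> = - (J ** transpose (F s) ** J ** ?K)"
      by (simp add: curvature_matrix_skew matrix_minus_right matrix_mul_assoc)
    finally have "J ** transpose (F s) ** J ** (?K ** G s) + J ** transpose (?K ** F s) ** J ** G s = 0"
      by (simp add: matrix_minus_left matrix_mul_assoc)
    with bounded_bilinear.has_vector_derivative[OF bounded_bilinear_matrix_matrix_mult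
        bounded_linear.has_vector_derivative[OF bounded_linear_pairing F[OF s]] G[OF s]]
    show ?thesis by simp
  qed
  then obtain B where "\<And>s. s \<in> I \<Longrightarrow> J ** transpose (F s) ** J ** G s = B"
    using has_vector_derivative_zero_constant is_interval_convex[OF I] by blast
  with that show ?thesis .
qed

lemma curvature_matrix_ode_exists:
  assumes I: "is_interval I" "c \<in> I" and k: "continuous_on I k"
  obtains F where
    "\<And>s. s \<in> I \<Longrightarrow> (F has_vector_derivative curvature_matrix (k s) ** F s) (at s within I)"
    "\<And>s. s \<in> I \<Longrightarrow> F s ** J ** transpose (F s) = J" "\<And>s. s \<in> I \<Longrightarrow> det (F s) = -1"
proof -
  define F0 where "F0 = frame (axis 1 1) (axis 3 1) (axis 4 1)"
  have F0: "F0 ** J ** transpose F0 = J" "det F0 = -1"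
    unfolding F0_def by (rule frame_orthonormal; simp add: inner22_def axis_def)+
  have "continuous_on I (\<lambda>s. curvature_matrix (k s))"
    by (rule bounded_linear.continuous_on[OF bounded_linear_curvature_matrix k])
  from linear_ode_exists[OF bounded_bilinear_matrix_matrix_mult I this, of F0] obtain F where
    c: "F c = F0" and F: "\<And>s. s \<in> I \<Longrightarrow> (F has_vector_derivative curvature_matrix (k s) ** F s) (at s within I)"
    by blast
  obtain B where B: "\<And>s. s \<in> I \<Longrightarrow> J ** transpose (F s) ** J ** F s = B"
    using pairing_constant[OF I(1) F F] by blast
  have "B = mat 1"
    using B[OF I(2)] gram_left_inverse[OF F0(1)] by (simp add: c)
  with B have orth: "F s ** J ** transpose (F s) = J" if "s \<in> I" for s
    using that by (intro gram_right_inverse) simp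
  \<comment> \<open>The Gram relation leaves only the values 1 and -1; by continuity the determinant
    is constant on the connected set \<open>I\<close>, and the initial frame decides the
    sign.\<close>
  have "det (F s) = 1 \<or> det (F s) = -1" if "s \<in> I" for s
  proof -
    have "det (F s) * det (F s) = 1"
      using arg_cong[OF orth[OF that], of det] by (simp add: det_mul)
    then show ?thesis by (simp add: square_eq_1_iff)
  qed
  then have "(\<lambda>s. det (F s)) ` I \<subseteq> {1, -1}" by auto
  then have "finite ((\<lambda>s. det (F s)) ` I)" by (rule finite_subset) simp
  moreover have "continuous_on I (\<lambda>s. det (F s))"
    using F by (intro differentiable_imp_continuous_on differentiable_on_det differentiable_onI_vector)
  moreover have "connected I" using I(1) by (rule is_interval_connected)
  ultimately have "(\<lambda>s. det (F s)) constant_on I"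
    by (intro continuous_finite_range_constant)
  then have "det (F s) = -1" if "s \<in> I" for s
    using that I(2) c F0(2) unfolding constant_on_def by metis
  with that F orth show ?thesis by blast
qed

text \<open>\<open>G' ** J ** transpose G\<close> collects the products of derivative rows with
  frame rows. It is skew because the Gram matrix is constant, which leaves six entries: four are the
  curvature up to sign, and two vanish by the framing condition.\<close>

lemma frame_ode:
  assumes I: "is_interval I" "interior I \<noteq> {}" and s: "s \<in> I"
    and curve: "framed_curve I \<gamma> v1 v2"
  shows "((\<lambda>s. frame (\<gamma> s) (v1 s) (v2 s)) has_vector_derivative
    curvature_matrix (curvature I \<gamma> v1 v2 s) ** frame (\<gamma> s) (v1 s) (v2 s)) (at s within I)"
proof -
  define G where "G s = frame (\<gamma> s) (v1 s) (v2 s)" for s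
  define k where "k = curvature I \<gamma> v1 v2 s"
  have "(\<lambda>s. (\<gamma> s, v1 s, v2 s)) differentiable_on I"
    using curve unfolding framed_curve_def by (blast intro: smooth_on_imp_differentiable_on)
  then have D: "((\<lambda>s. (\<gamma> s, v1 s, v2 s)) has_vector_derivative deriv_on I (\<lambda>s. (\<gamma> s, v1 s, v2 s)) t) (at t within I)"
    if "t \<in> I" for t using that by (rule deriv_on_works)
  have "\<gamma> differentiable_on I" "v1 differentiable_on I" "v2 differentiable_on I"
    using bounded_linear.has_vector_derivative[OF bounded_linear_fst D]
      bounded_linear.has_vector_derivative[OF bounded_linear_compose[OF bounded_linear_fst bounded_linear_snd] D]
      bounded_linear.has_vector_derivative[OF bounded_linear_compose[OF bounded_linear_snd bounded_linear_snd] D]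
    by (auto intro!: differentiable_onI_vector)
  then have "G differentiable_on I"
    unfolding G_def[abs_def] by (rule differentiable_on_frame)
  from deriv_on_works[OF this s] obtain G' where G': "(G has_vector_derivative G') (at s within I)" by blast
  have rows: "deriv_on I \<gamma> s = G' $ 2" "deriv_on I v1 s = G' $ 3" "deriv_on I v2 s = G' $ 4"
    using bounded_linear.has_vector_derivative[OF bounded_linear_vec_nth G', of 2]
      bounded_linear.has_vector_derivative[OF bounded_linear_vec_nth G', of 3]
      bounded_linear.has_vector_derivative[OF bounded_linear_vec_nth G', of 4]
    by (simp_all add: G_def frame_def deriv_on_eqI[OF I s])
  have orth: "G t ** J ** transpose (G t) = J" if "t \<in> I" for t
    using curve that unfolding G_def framed_curve_def
    by (intro frame_orthonormal) (auto simp: AdS3_def Delta5_def S32_def)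
  have "((\<lambda>s. G s ** J ** transpose (G s)) has_vector_derivative
      G s ** J ** transpose G' + G' ** J ** transpose (G s)) (at s within I)"
    by (intro bounded_bilinear.has_vector_derivative[OF bounded_bilinear_matrix_matrix_mult]
        bounded_linear.has_vector_derivative[OF bounded_bilinear.bounded_linear_left[OF bounded_bilinear_matrix_matrix_mult]]
        bounded_linear.has_vector_derivative[OF bounded_linear_transpose] G')
  moreover have "((\<lambda>s. G s ** J ** transpose (G s)) has_vector_derivative 0) (at s within I)"
    using has_vector_derivative_transform[OF s orth has_vector_derivative_const] by simp
  ultimately have gram_deriv: "G s ** J ** transpose G' + G' ** J ** transpose (G s) = 0"
    using vector_derivative_unique_within at_within_interval_neq_bot[OF I s] by blast
  have skew: "inner22 (G s $ i) (G' $ j) + inner22 (G' $ i) (G s $ j) = 0" for i j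
    using arg_cong[OF gram_deriv, of "\<lambda>X. X $ i $ j"]
    by (simp only: vector_add_component J_gram_nth zero_index)
  have sym: "inner22 y z = inner22 z y" for y z by (simp add: inner22_def)
  have diag: "inner22 (G' $ i) (G s $ i) = 0" for i
    using skew[of i i] sym[of "G' $ i"] by simp
  have skew': "inner22 (G' $ i) (G s $ j) = - inner22 (G' $ j) (G s $ i)" for i j
    using skew[of i j] sym[of "G' $ j"] by simp
  have k_eq: "k = (- inner22 (G' $ 2) (G s $ 1), inner22 (G' $ 3) (G s $ 4),
      - inner22 (G' $ 3) (G s $ 1), - inner22 (G' $ 4) (G s $ 1))"
    by (simp add: k_def curvature_def Let_def rows) (simp add: G_def frame_def)
  have zero: "inner22 (G' $ 2) (G s $ 3) = 0" "inner22 (G' $ 2) (G s $ 4) = 0"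
    using curve s unfolding framed_curve_def G_def frame_def by (simp_all flip: rows)
  have "(G' ** J ** transpose (G s)) $ i $ j = (curvature_matrix k ** J) $ i $ j" for i j
    using exhaust_4[of i] exhaust_4[of j] diag zero
      skew'[of 1 2] skew'[of 1 3] skew'[of 1 4] skew'[of 3 2] skew'[of 4 2] skew'[of 4 3]
    unfolding J_gram_nth k_eq
    by (auto simp: curvature_matrix_def matrix_matrix_mult_def sum_4 axis_def)
  then have W: "G' ** J ** transpose (G s) = curvature_matrix k ** J"
    by (simp add: vec_eq_iff)
  \<comment> \<open>Inverting the orthonormal frame recovers the derivative from its products with
    the frame.\<close>
  have "G' = G' ** (J ** transpose (G s) ** J ** G s)"
    by (simp add: gram_left_inverse[OF orth[OF s]])
  also have "\<dots> = (G' ** J ** transpose (G s)) ** J ** G s"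
    by (simp add: matrix_mul_assoc)
  also have "\<dots> = curvature_matrix k ** (J ** J) ** G s"
    unfolding W by (simp only: matrix_mul_assoc)
  also have "\<dots> = curvature_matrix k ** G s" by simp
  finally show ?thesis using G' by (simp add: G_def[abs_def] k_def)
qed

text \<open>The converse of \<open>frame_ode\<close>: the products of derivative rows with frame
  rows are the entries of \<open>curvature_matrix (k s) ** J\<close>, and the framing condition and
  the curvature are read off from them.\<close>

lemma framed_curve_of_ode:
  assumes I: "is_interval I" "interior I \<noteq> {}" and k: "smooth_on I k"
    and F: "\<And>s. s \<in> I \<Longrightarrow> (F has_vector_derivative curvature_matrix (k s) ** F s) (at s within I)"
    and orth: "\<And>s. s \<in> I \<Longrightarrow> F s ** J ** transpose (F s) = J" and det: "\<And>s. s \<in> I \<Longrightarrow> det (F s) = -1"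
  shows "framed_curve I (\<lambda>s. F s $ 2) (\<lambda>s. F s $ 3) (\<lambda>s. F s $ 4)"
    and "s \<in> I \<Longrightarrow> curvature I (\<lambda>s. F s $ 2) (\<lambda>s. F s $ 3) (\<lambda>s. F s $ 4) s = k s"
proof -
  have deriv: "deriv_on I (\<lambda>s. F s $ i) s = (curvature_matrix (k s) ** F s) $ i" if "s \<in> I" for i s
    using bounded_linear.has_vector_derivative[OF bounded_linear_vec_nth F[OF that]]
    by (rule deriv_on_eqI[OF I that])
  have inner: "inner22 (F s $ i) (F s $ j) = J $ i $ j" if "s \<in> I" for i j s
    using orth[OF that] by (simp only: J_gram_nth[symmetric])
  have inner_F: "inner22 (F s $ 2) (F s $ 2) = -1" "inner22 (F s $ 3) (F s $ 3) = 1"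
    "inner22 (F s $ 4) (F s $ 4) = 1" "inner22 (F s $ 2) (F s $ 3) = 0"
    "inner22 (F s $ 2) (F s $ 4) = 0" "inner22 (F s $ 3) (F s $ 4) = 0" if "s \<in> I" for s
    unfolding inner[OF that] by (simp_all add: axis_def)
  have inner': "inner22 ((curvature_matrix (k s) ** F s) $ i) (F s $ j) = (curvature_matrix (k s) ** J) $ i $ j"
    if "s \<in> I" for i j s
  proof -
    have "curvature_matrix (k s) ** F s ** J ** transpose (F s) = curvature_matrix (k s) ** J"
      using orth[OF that] by (simp flip: matrix_mul_assoc)
    then show ?thesis by (simp only: J_gram_nth[symmetric])
  qed
  have KJ: "(curvature_matrix (k s) ** J) $ 2 $ 3 = 0" "(curvature_matrix (k s) ** J) $ 2 $ 4 = 0"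
    "k s = (- (curvature_matrix (k s) ** J) $ 2 $ 1, (curvature_matrix (k s) ** J) $ 3 $ 4,
      - (curvature_matrix (k s) ** J) $ 3 $ 1, - (curvature_matrix (k s) ** J) $ 4 $ 1)" for s
    by (cases "k s"; simp add: curvature_matrix_def matrix_matrix_mult_def sum_4 axis_def)+
  have "smooth_on I F"
    using smooth_on_linear_ode_solution[OF I bounded_bilinear_matrix_matrix_mult
        smooth_on_linear[OF I bounded_linear_curvature_matrix k] F] .
  then have "smooth_on I (\<lambda>s. (F s $ 2, F s $ 3, F s $ 4))"
    by (intro smooth_on_linear[OF I, of "\<lambda>X. (X $ 2, X $ 3, X $ 4)"] bounded_linear_Pair bounded_linear_vec_nth)
  then show "framed_curve I (\<lambda>s. F s $ 2) (\<lambda>s. F s $ 3) (\<lambda>s. F s $ 4)"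
    unfolding framed_curve_def
    by (simp add: AdS3_def Delta5_def S32_def inner_F inner' deriv KJ(1,2))
  show "curvature I (\<lambda>s. F s $ 2) (\<lambda>s. F s $ 3) (\<lambda>s. F s $ 4) s = k s" if "s \<in> I"
    unfolding curvature_def Let_def triple_prod_of_orthonormal[OF orth[OF that] det[OF that]]
    by (subst KJ(3)) (simp only: deriv[OF that] inner'[OF that])
qed

lemma congruent_of_ode:
  assumes I: "is_interval I" "c \<in> I"
    and F: "\<And>s. s \<in> I \<Longrightarrow> (F has_vector_derivative curvature_matrix (k s) ** F s) (at s within I)"
    and G: "\<And>s. s \<in> I \<Longrightarrow> (G has_vector_derivative curvature_matrix (k s) ** G s) (at s within I)"
    and F_orth: "\<And>s. s \<in> I \<Longrightarrow> F s ** J ** transpose (F s) = J" and G_orth: "G c ** J ** transpose (G c) = J"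
    and det: "det (F c) = -1" "det (G c) = -1"
  obtains A where "A \<in> SO22" "\<And>s i. s \<in> I \<Longrightarrow> G s $ i = A *v (F s $ i)"
proof -
  obtain B where B: "\<And>s. s \<in> I \<Longrightarrow> J ** transpose (F s) ** J ** G s = B"
    using pairing_constant[OF I(1) F G] by blast
  have G_eq: "G s = F s ** B" if "s \<in> I" for s
  proof -
    have "F s ** B = (F s ** J ** transpose (F s)) ** J ** G s"
      by (simp add: matrix_mul_assoc flip: B[OF that])
    then show ?thesis by (simp add: F_orth[OF that])
  qed
  have "det B = 1"
    using arg_cong[OF G_eq[OF I(2)], of det] det by (simp add: det_mul)
  \<comment> \<open>\<open>B\<close> is expanded at \<open>c\<close>; the Gram matrix of
    \<open>G c\<close> appears in the middle and collapses to \<open>J\<close>, after which that of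
    \<open>F c\<close> cancels.\<close>
  have "B ** J ** transpose B = J ** transpose (F c) ** J ** (G c ** J ** transpose (G c)) ** J ** F c ** J"
    by (simp add: matrix_transpose_mul matrix_mul_assoc flip: B[OF I(2)])
  also have "\<dots> = (J ** transpose (F c) ** (J ** J) ** J ** F c) ** J"
    unfolding G_orth by (simp only: matrix_mul_assoc)
  also have "\<dots> = J"
    by (simp add: gram_left_inverse[OF F_orth[OF I(2)]])
  finally have BJB: "B ** J ** transpose B = J" .
  have "inner22 (transpose B *v u) (transpose B *v w) = inner22 u w" for u w
  proof -
    have "inner22 (transpose B *v u) (transpose B *v w) = u \<bullet> (B *v (J *v (transpose B *v w)))"
      by (simp only: inner22_J transpose_matrix_vector dot_lmul_matrix)
    also have "\<dots> = u \<bullet> ((B ** J ** transpose B) *v w)"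
      by (simp only: matrix_vector_mul_assoc matrix_mul_assoc)
    finally show ?thesis by (simp only: BJB inner22_J)
  qed
  with \<open>det B = 1\<close> have "transpose B \<in> SO22" by (simp add: SO22_def)
  \<comment> \<open>Frame vectors are rows, so right multiplication by \<open>B\<close> acts on each
    of them as \<open>transpose B\<close>.\<close>
  moreover have "G s $ i = transpose B *v (F s $ i)" if "s \<in> I" for s i
    unfolding G_eq[OF that]
    by (simp add: vec_eq_iff matrix_matrix_mult_def matrix_vector_mult_def transpose_def mult.commute)
  ultimately show ?thesis by (rule that)
qed

text \<open>Nonempty interior excludes one-point intervals, where derivatives within
  \<open>I\<close> are not determined.\<close>

theorem theorem3p7:
  fixes I :: "real set" and \<alpha> l m n :: "real \<Rightarrow> real"
  assumes "is_interval I" and "interior I \<noteq> {}"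
    and "smooth_on I (\<lambda>s. (\<alpha> s, l s, m s, n s))"
  shows "\<exists>\<gamma> v1 v2.
    framed_curve I \<gamma> v1 v2 \<and>
    (\<forall>s\<in>I. curvature I \<gamma> v1 v2 s = (\<alpha> s, l s, m s, n s)) \<and>
    (\<forall>\<eta> w1 w2.
      framed_curve I \<eta> w1 w2 \<and>
      (\<forall>s\<in>I. curvature I \<eta> w1 w2 s = (\<alpha> s, l s, m s, n s)) \<longrightarrow>
      (\<exists>A\<in>SO22. \<forall>s\<in>I. \<eta> s = A *v \<gamma> s \<and> w1 s = A *v v1 s \<and> w2 s = A *v v2 s))"
proof -
  define k where "k s = (\<alpha> s, l s, m s, n s)" for s
  note I = assms(1,2)
  have k: "smooth_on I k" using assms(3) by (simp add: k_def[abs_def])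
  obtain c where c: "c \<in> I" using I(2) interior_subset by blast
  obtain F where F: "\<And>s. s \<in> I \<Longrightarrow> (F has_vector_derivative curvature_matrix (k s) ** F s) (at s within I)"
    and orth: "\<And>s. s \<in> I \<Longrightarrow> F s ** J ** transpose (F s) = J"
    and det: "\<And>s. s \<in> I \<Longrightarrow> det (F s) = -1"
    using curvature_matrix_ode_exists[OF I(1) c
        differentiable_imp_continuous_on[OF smooth_on_imp_differentiable_on[OF k]]] by blast
  note curve = framed_curve_of_ode[OF I k F orth det]
  have "\<exists>A\<in>SO22. \<forall>s\<in>I. \<eta> s = A *v (F s $ 2) \<and> w1 s = A *v (F s $ 3) \<and> w2 s = A *v (F s $ 4)"
    if \<eta>: "framed_curve I \<eta> w1 w2" "\<forall>s\<in>I. curvature I \<eta> w1 w2 s = k s" for \<eta> w1 w2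
  proof -
    define G where "G s = frame (\<eta> s) (w1 s) (w2 s)" for s
    have G: "(G has_vector_derivative curvature_matrix (k s) ** G s) (at s within I)" if "s \<in> I" for s
      using frame_ode[OF I that \<eta>(1)] \<eta>(2) that by (simp add: G_def[abs_def])
    \<comment> \<open>The Gram matrix and determinant of the second frame are compared with the
      first at the base point \<open>c\<close>; the constant pairing carries the congruence to all
      of \<open>I\<close>.\<close>
    have "inner22 (\<eta> c) (\<eta> c) = -1" "inner22 (w1 c) (w1 c) = 1" "inner22 (w2 c) (w2 c) = 1"
      "inner22 (\<eta> c) (w1 c) = 0" "inner22 (\<eta> c) (w2 c) = 0" "inner22 (w1 c) (w2 c) = 0"
      using \<eta>(1) c unfolding framed_curve_def by (auto simp: AdS3_def Delta5_def S32_def)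
    note Gc = frame_orthonormal[OF this, folded G_def]
    obtain A where "A \<in> SO22" and A: "\<And>s i. s \<in> I \<Longrightarrow> G s $ i = A *v (F s $ i)"
      using congruent_of_ode[OF I(1) c F G orth Gc(1) det[OF c] Gc(2)] by blast
    have "\<forall>s\<in>I. \<eta> s = A *v (F s $ 2) \<and> w1 s = A *v (F s $ 3) \<and> w2 s = A *v (F s $ 4)"
      by (simp add: G_def frame_def flip: A)
    with \<open>A \<in> SO22\<close> show ?thesis by blast
  qed
  with curve show ?thesis unfolding k_def by blast
qed

end
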